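(* Let $\mathcal{T}$ be a triangle with circumcircle $\mathcal{C}$, and let $D$ be a point lying neither on the sides of $\mathcal{T}$ nor on $\mathcal{C}$. Let $\mathcal{E}_D$ be the pedal-circle of $\mathcal{T}$ with respect to $D$ and $\gamma_D$ the i-conic of $\mathcal{T}$ focused in $D$. Let $C$ be a point located on $\mathcal{C}$. Let the circle of diameter $[CD]$ intersect $\mathcal{E}_D$ in $A_D$ and $B_D$, and let the lines $CA_D$ and $CB_D$ intersect $\mathcal{C}$ again in $B$ and $A$, respectively. Then the line $AB$ is tangent to $\gamma_D$, and the foot of the perpendicular from $D$ to $AB$ lies on the circle $\mathcal{E}_D$. All poristic triangles (the triangles inscribed in $\mathcal{C}$ and circumscribed to $\gamma_D$) are obtainable in this manner.
   Context: All objects are in the Euclidean plane. A "side" of a triangle means the line through two of its vertices. A triangle is inscribed in a curve if its vertices lie on it, and circumscribed to a conic if its sides are tangent to the conic. The pedal triangle of $\mathcal{T}$ with respect to $D$ has as vertices the projections of $D$ on the sides of $\mathcal{T}$; the pedal-circle $\mathcal{E}_D$ is the circumcircle of the pedal triangle. The i-conic of $\mathcal{T}$ focused in $D$ is the conic having $D$ as a focus and tangent to the three sides of $\mathcal{T}$. The construction presupposes that the named intersections exist; a necessary condition is that $C$ lie outside $\gamma_D$, so that there are tangents from $C$ to $\gamma_D$. *)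

theory Defs
  imports "HOL-Analysis.Analysis"
begin

definition is_circumcircle :: "(real^2) set \<Rightarrow> real^2 \<Rightarrow> real^2 \<Rightarrow> real^2 \<Rightarrow> bool" where
  "is_circumcircle K P Q R \<longleftrightarrow>
     (\<exists>c r. r > 0 \<and> K = sphere c r) \<and> P \<in> K \<and> Q \<in> K \<and> R \<in> K"

definition foot :: "real^2 \<Rightarrow> (real^2) set \<Rightarrow> real^2" where
  "foot D L = (THE F. F \<in> L \<and> (\<forall>X\<in>L. orthogonal (D - F) (X - F)))"

definition is_pedal_circle :: "(real^2) set \<Rightarrow> real^2 \<Rightarrow> real^2 \<Rightarrow> real^2 \<Rightarrow> real^2 \<Rightarrow> bool" where
  "is_pedal_circle E P Q R D \<longleftrightarrow>
     is_circumcircle E (foot D (affine hull {Q, R})) (foot D (affine hull {R, P}))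
       (foot D (affine hull {P, Q}))"

text \<open>
  A conic is given by its equation \<open>q X = 0\<close>, where \<open>q\<close> is a quadratic polynomial function,
  determined up to a nonzero factor \<open>k\<close>.  It has focus \<open>D\<close> if it is a circle with centre \<open>D\<close>
  or if it is the locus \<open>dist X D = e * infdist X l\<close> for some eccentricity \<open>e > 0\<close> and some
  directrix \<open>l\<close> (the line \<open>UV\<close>) not through \<open>D\<close>; the equation is obtained by squaring, so that
  for \<open>e > 1\<close> both branches of the hyperbola are included.  All these conics are nondegenerate.
\<close>
definition conic_with_focus :: "(real^2 \<Rightarrow> real) \<Rightarrow> real^2 \<Rightarrow> bool" where
  "conic_with_focus q D \<longleftrightarrow>
     (\<exists>k. k \<noteq> 0 \<and>
       ((\<exists>r>0. \<forall>X. q X = k * ((dist X D)\<^sup>2 - r\<^sup>2)) \<or>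
        (\<exists>e>0. \<exists>U V. U \<noteq> V \<and> D \<notin> affine hull {U, V} \<and>
           (\<forall>X. q X = k * ((dist X D)\<^sup>2 - (e * infdist X (affine hull {U, V}))\<^sup>2)))))"

text \<open>
  The line \<open>AB\<close> is tangent to the conic if it meets it in a double point.  The first alternative
  is contact at the point with parameter \<open>s\<close>; in the second one, \<open>q\<close> is a nonzero constant on the
  line, which means contact at the point at infinity of the line: the line is an
  asymptote of a hyperbola.  Asymptotes have to count as tangents, since a side of a triangle
  circumscribed to a hyperbola may become an asymptote.
\<close>
definition tangent_line :: "(real^2 \<Rightarrow> real) \<Rightarrow> real^2 \<Rightarrow> real^2 \<Rightarrow> bool" where
  "tangent_line q A B \<longleftrightarrow> A \<noteq> B \<and>
     (\<exists>k. k \<noteq> 0 \<and>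
       ((\<exists>s. \<forall>t. q (A + t *\<^sub>R (B - A)) = k * (t - s)\<^sup>2) \<or>
        (\<forall>t. q (A + t *\<^sub>R (B - A)) = k)))"

definition circumscribed :: "real^2 \<Rightarrow> real^2 \<Rightarrow> real^2 \<Rightarrow> (real^2 \<Rightarrow> real) \<Rightarrow> bool" where
  "circumscribed P Q R q \<longleftrightarrow> tangent_line q P Q \<and> tangent_line q Q R \<and> tangent_line q R P"

definition is_i_conic :: "(real^2 \<Rightarrow> real) \<Rightarrow> real^2 \<Rightarrow> real^2 \<Rightarrow> real^2 \<Rightarrow> real^2 \<Rightarrow> bool" where
  "is_i_conic q P Q R D \<longleftrightarrow> conic_with_focus q D \<and> circumscribed P Q R q"

definition poristic_triangle ::
    "(real^2) set \<Rightarrow> (real^2 \<Rightarrow> real) \<Rightarrow> real^2 \<Rightarrow> real^2 \<Rightarrow> real^2 \<Rightarrow> bool" where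
  "poristic_triangle K q X Y Z \<longleftrightarrow>
     \<not> collinear {X, Y, Z} \<and> X \<in> K \<and> Y \<in> K \<and> Z \<in> K \<and> circumscribed X Y Z q"

text \<open>
  \<open>A\<close> and \<open>B\<close> result from the construction starting at the point \<open>C\<close> of the circle \<open>K\<close>.  All
  the named objects are required to exist: there are two intersection points \<open>A\<^sub>D\<close>, \<open>B\<^sub>D\<close>, they
  differ from \<open>C\<close> (so that the lines are defined), and the lines meet \<open>K\<close> again outside \<open>C\<close>.
\<close>
definition construction ::
    "(real^2) set \<Rightarrow> (real^2) set \<Rightarrow> real^2 \<Rightarrow> real^2 \<Rightarrow> real^2 \<Rightarrow> real^2 \<Rightarrow> bool" where
  "construction K E D C A B \<longleftrightarrow> C \<in> K \<and>
     (\<exists>A\<^sub>D B\<^sub>D. A\<^sub>D \<noteq> B\<^sub>D \<and>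
        sphere (midpoint C D) (dist C D / 2) \<inter> E = {A\<^sub>D, B\<^sub>D} \<and>
        A\<^sub>D \<noteq> C \<and> B\<^sub>D \<noteq> C \<and>
        B \<in> affine hull {C, A\<^sub>D} \<inter> K \<and> B \<noteq> C \<and>
        A \<in> affine hull {C, B\<^sub>D} \<inter> K \<and> A \<noteq> C)"

end

theory Submission
  imports Defs
begin

text \<open>
  The conic with focus \<open>D\<close> has an equation \<open>|X - D|\<^sup>2 = (a \<bullet> (X - D) + b)\<^sup>2\<close> with \<open>b \<noteq> 0\<close>.
  Restricting it to a line \<open>AB\<close> gives a polynomial of degree at most two whose discriminant
  vanishes exactly if the foot \<open>F\<close> of \<open>D\<close> on \<open>AB\<close> satisfies
  \<open>(|a|\<^sup>2 - 1) |F - D|\<^sup>2 + 2 b a \<bullet> (F - D) + b\<^sup>2 = 0\<close>.  This is the equation of a circle or of a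
  line, and it holds at the three feet on the sides of the triangle, which are distinct points
  of the pedal circle.  So it is the equation of the pedal circle: a line is tangent to the
  conic if and only if the foot of \<open>D\<close> on it lies on \<open>E\<close>, and \<open>D\<close> itself is not on \<open>E\<close>
  (\<open>tangent_line_iff_foot_on_pedal_circle\<close>).

  The porism thereby becomes a closure property of the chords of \<open>K\<close> whose foot lies on \<open>E\<close>.
  Take \<open>K\<close> as the unit circle of the complex plane, let \<open>d\<close> represent \<open>D\<close> and let \<open>f\<close> be the
  reflection of \<open>d\<close> in the centre of \<open>E\<close>, that is, the other focus.  The chord \<open>uv\<close> has the
  property if and only if \<open>(u + v - u v d' - f) (u + v - d - u v f') = M u v\<close>, where \<open>M\<close> is the
  squared diameter of \<open>E\<close> and the prime is conjugation.  For given \<open>u\<close> this is quadratic in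
  \<open>v\<close>, so Vieta's formulas describe the two chords issuing from a point.  They show that the
  three vertices of an inscribed triangle with this property are the roots of
  \<open>z (z - d) (z - f) = l (1 - d' z) (1 - f' z)\<close>, with \<open>l\<close> the product of the vertices, and that
  \<open>M = |1 - d' f|\<^sup>2\<close> (\<open>porism_condition\<close>).  This equation no longer mentions the triangle, and
  conversely it makes the third chord close up whenever the two others have the property
  (\<open>porism_closes\<close>).

  By Thales, the circle with diameter \<open>CD\<close> meets \<open>E\<close> in the feet of \<open>D\<close> on the tangents through
  \<open>C\<close>.  That settles the first claim, and also the second one, provided that no foot on a side
  through \<open>C\<close> is \<open>C\<close> itself.  This can happen at some vertices of a poristic triangle, but not
  at one whose distance from \<open>D\<close> is maximal, since the foot is the point of the side nearest
  to \<open>D\<close>.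
\<close>

section \<open>Chords of the unit circle and their feet on a circle\<close>

text \<open>
  For \<open>u\<close>, \<open>v\<close> on the unit circle, \<open>(d + u + v - u v d') / 2\<close> is the foot of \<open>d\<close> on the chord
  \<open>uv\<close>, and the equation says that its distance \<open>\<rho>\<close> from \<open>(d + f) / 2\<close> satisfies
  \<open>4 \<rho>\<^sup>2 = M\<close>: the product of the two factors, divided by \<open>u v\<close>, is a number times its
  conjugate.  Cleared of denominators, the relation is polynomial in \<open>u\<close> and \<open>v\<close>.
\<close>
definition pedal_rel :: "complex \<Rightarrow> complex \<Rightarrow> complex \<Rightarrow> complex \<Rightarrow> complex \<Rightarrow> bool" where
  "pedal_rel d f M u v \<longleftrightarrow>
     (u + v - u * v * cnj d - f) * (u + v - d - u * v * cnj f) = M * (u * v)"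

text \<open>
  As an equation for \<open>z\<close>, \<open>pedal_rel d f M w z\<close> is quadratic with leading coefficient \<open>\<alpha>\<close>.  The
  formulas stay free of division by \<open>\<alpha>\<close>, so that they also cover \<open>\<alpha> = 0\<close>.
\<close>
lemma pedal_rel_vieta:
  assumes u: "pedal_rel d f M w u" and v: "pedal_rel d f M w v" and "u \<noteq> v"
  defines "\<alpha> \<equiv> (1 - w * cnj d) * (1 - w * cnj f)"
  shows "\<alpha> * (u * v) = (w - f) * (w - d)"
    and "\<alpha> * (u + v) = M * w - (w - f) * (1 - w * cnj f) - (w - d) * (1 - w * cnj d)"
proof -
  define \<beta> where "\<beta> = (w - f) * (1 - w * cnj f) + (w - d) * (1 - w * cnj d) - M * w"
  define \<delta> where "\<delta> = (w - f) * (w - d)"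
  have 1: "\<alpha> * u^2 + \<beta> * u + \<delta> = 0" and 2: "\<alpha> * v^2 + \<beta> * v + \<delta> = 0"
    using u v unfolding pedal_rel_def \<alpha>_def \<beta>_def \<delta>_def by algebra+
  have "(u - v) * (\<alpha> * (u + v) + \<beta>) = 0"
    using 1 2 by algebra
  then have 3: "\<alpha> * (u + v) + \<beta> = 0"
    using \<open>u \<noteq> v\<close> by simp
  then show "\<alpha> * (u + v) = M * w - (w - f) * (1 - w * cnj f) - (w - d) * (1 - w * cnj d)"
    unfolding \<beta>_def by algebra
  show "\<alpha> * (u * v) = (w - f) * (w - d)"
    using 1 3 unfolding \<delta>_def by algebra
qed

lemma cubic_three_roots_sum:
  fixes u v w s p l :: "'a::idom"
  assumes "u \<noteq> v" "v \<noteq> w" "w \<noteq> u"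
    and u: "u^3 - s * u^2 + p * u = l" and v: "v^3 - s * v^2 + p * v = l"
    and w: "w^3 - s * w^2 + p * w = l"
  shows "u + v + w = s"
proof -
  have "(u - v) * (u^2 + u * v + v^2 - s * (u + v) + p) = (u^3 - s * u^2 + p * u) - (v^3 - s * v^2 + p * v)"
    by (simp add: algebra_simps power2_eq_square power3_eq_cube)
  also have "\<dots> = 0" using u v by simp
  finally have 1: "u^2 + u * v + v^2 - s * (u + v) + p = 0" using assms(1) by simp
  have "(w - v) * (w^2 + w * v + v^2 - s * (w + v) + p) = (w^3 - s * w^2 + p * w) - (v^3 - s * v^2 + p * v)"
    by (simp add: algebra_simps power2_eq_square power3_eq_cube)
  also have "\<dots> = 0" using w v by simp
  finally have 2: "w^2 + w * v + v^2 - s * (w + v) + p = 0" using assms(2) by simp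
  have "(w - u) * (u + v + w - s) = 0" using 1 2 by algebra
  then show ?thesis using assms(3) by simp
qed

text \<open>
  The product formula of Vieta at each vertex \<open>z\<close> says that \<open>z\<close> is a root of the cubic
  \<open>z (z - d) (z - f) = l (1 - d' z) (1 - f' z)\<close>.  Hence \<open>u + v + w\<close> is known from the coefficients,
  and comparison with Vieta's formula for the sum at \<open>w\<close> determines \<open>M\<close>.
\<close>
lemma porism_condition:
  assumes dist: "u \<noteq> v" "v \<noteq> w" "w \<noteq> u" and "w \<noteq> 0"
    and uv: "pedal_rel d f M u v" and vw: "pedal_rel d f M v w" and wu: "pedal_rel d f M w u"
  shows "M = (1 - cnj d * f) * (1 - d * cnj f)"
proof -
  define l where "l = u * v * w"
  have sym: "pedal_rel d f M v u" "pedal_rel d f M w v" "pedal_rel d f M u w"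
    using uv vw wu unfolding pedal_rel_def by (simp_all add: algebra_simps)
  define s where "s = d + f + l * cnj d * cnj f"
  define p where "p = d * f + l * (cnj d + cnj f)"
  note V = pedal_rel_vieta[OF wu sym(2)] pedal_rel_vieta[OF sym(1) vw] pedal_rel_vieta[OF uv sym(3)]
  have ne: "u \<noteq> v" "v \<noteq> u" "v \<noteq> w" "u \<noteq> w" using dist by auto
  have "w^3 - s * w^2 + p * w = l"
    using V(1)[OF ne(1)] unfolding l_def s_def p_def by algebra
  moreover have "v^3 - s * v^2 + p * v = l"
    using V(3)[OF ne(4)] unfolding l_def s_def p_def by algebra
  moreover have "u^3 - s * u^2 + p * u = l"
    using V(5)[OF ne(3)] unfolding l_def s_def p_def by algebra
  ultimately have s: "u + v + w = s"
    using cubic_three_roots_sum dist by blast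
  have "w * (M - (1 - cnj d * f) * (1 - d * cnj f)) = 0"
    using V(1,2)[OF ne(1)] s unfolding l_def s_def by algebra
  then show ?thesis using \<open>w \<noteq> 0\<close> by simp
qed

text \<open>
  Once \<open>M\<close> has this value, Vieta's formulas at \<open>w\<close> express the two factors of the relation
  between \<open>u\<close> and \<open>v\<close> as \<open>(d - w) (1 - d' f) / (1 - d' w)\<close> and
  \<open>(f - w) (1 - d f') / (1 - f' w)\<close>.  Their product is \<open>M\<close> times \<open>u v\<close>, by the formula for
  \<open>u v\<close>.
\<close>
lemma porism_closes:
  assumes wu: "pedal_rel d f M w u" and wv: "pedal_rel d f M w v" and "u \<noteq> v"
    and M: "M = (1 - cnj d * f) * (1 - d * cnj f)"
    and nz: "1 - w * cnj d \<noteq> 0" "1 - w * cnj f \<noteq> 0"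
  shows "pedal_rel d f M u v"
proof -
  note V = pedal_rel_vieta[OF wu wv \<open>u \<noteq> v\<close>]
  define \<alpha> where "\<alpha> = (1 - w * cnj d) * (1 - w * cnj f)"
  have \<alpha>: "\<alpha> \<noteq> 0" using nz by (simp add: \<alpha>_def)
  have "\<alpha> * (u + v + w) = \<alpha> * (d + f + u * v * w * cnj d * cnj f)"
    using V M unfolding \<alpha>_def by algebra
  then have s: "u + v + w = d + f + u * v * w * cnj d * cnj f"
    using \<alpha> by simp
  have 1: "(1 - w * cnj d) * (u + v - u * v * cnj d - f) = (d - w) * (1 - cnj d * f)"
  proof -
    have "(1 - w * cnj d) * (u + v - u * v * cnj d - f)
          = (1 - w * cnj d) * (d - w) - cnj d * (\<alpha> * (u * v))"
      using s unfolding \<alpha>_def by algebra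
    then show ?thesis using V(1) unfolding \<alpha>_def by algebra
  qed
  have 2: "(1 - w * cnj f) * (u + v - d - u * v * cnj f) = (f - w) * (1 - d * cnj f)"
  proof -
    have "(1 - w * cnj f) * (u + v - d - u * v * cnj f)
          = (1 - w * cnj f) * (f - w) - cnj f * (\<alpha> * (u * v))"
      using s unfolding \<alpha>_def by algebra
    then show ?thesis using V(1) unfolding \<alpha>_def by algebra
  qed
  have "\<alpha> * ((u + v - u * v * cnj d - f) * (u + v - d - u * v * cnj f))
      = ((1 - w * cnj d) * (u + v - u * v * cnj d - f)) * ((1 - w * cnj f) * (u + v - d - u * v * cnj f))"
    unfolding \<alpha>_def by (simp add: mult_ac)
  also have "\<dots> = ((w - f) * (w - d)) * M"
    unfolding 1 2 M by algebra
  also have "\<dots> = \<alpha> * (M * (u * v))"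
    using V(1) unfolding \<alpha>_def by (simp add: mult_ac)
  finally show ?thesis using \<alpha> unfolding pedal_rel_def by simp
qed

section \<open>Feet of perpendiculars, and affine functions on circles\<close>

lemma foot_unique:
  fixes A B D F :: "real^2"
  assumes "F \<in> affine hull {A, B}" and "(D - F) \<bullet> (B - A) = 0"
  shows "foot D (affine hull {A, B}) = F"
  unfolding foot_def
proof (rule the_equality)
  show "F \<in> affine hull {A, B} \<and> (\<forall>X\<in>affine hull {A, B}. orthogonal (D - F) (X - F))"
  proof (intro conjI ballI)
    fix X assume "X \<in> affine hull {A, B}"
    with assms obtain s t where "X = A + s *\<^sub>R (B - A)" "F = A + t *\<^sub>R (B - A)"
      by (auto simp: affine_hull_2_alt)
    then have "X - F = (s - t) *\<^sub>R (B - A)" by (simp add: scaleR_left_diff_distrib)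
    with assms(2) show "orthogonal (D - F) (X - F)" by (simp add: orthogonal_def)
  qed (use assms in auto)
next
  fix G assume G: "G \<in> affine hull {A, B} \<and> (\<forall>X\<in>affine hull {A, B}. orthogonal (D - G) (X - G))"
  then obtain s t where st: "G = A + s *\<^sub>R (B - A)" "F = A + t *\<^sub>R (B - A)"
    using assms(1) by (auto simp: affine_hull_2_alt)
  then have FG: "F - G = (t - s) *\<^sub>R (B - A)" by (simp add: scaleR_left_diff_distrib)
  have "(D - G) \<bullet> (F - G) = 0" "(D - F) \<bullet> (F - G) = 0"
    using G assms FG by (auto simp: orthogonal_def)
  then have "(F - G) \<bullet> (F - G) = 0" by (simp add: inner_diff_left)
  then show "G = F" by simp
qed

lemma foot_exists:
  fixes A B D :: "real^2"
  assumes "A \<noteq> B"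
  obtains t where "foot D (affine hull {A, B}) = A + t *\<^sub>R (B - A)"
    and "(D - (A + t *\<^sub>R (B - A))) \<bullet> (B - A) = 0"
proof
  define t where "t = ((D - A) \<bullet> (B - A)) / ((B - A) \<bullet> (B - A))"
  have "(B - A) \<bullet> (B - A) \<noteq> 0" using assms by simp
  then have "t * ((B - A) \<bullet> (B - A)) = (D - A) \<bullet> (B - A)" by (simp add: t_def)
  then show o: "(D - (A + t *\<^sub>R (B - A))) \<bullet> (B - A) = 0"
    unfolding diff_diff_eq[symmetric] inner_diff_left[of "D - A"] inner_scaleR_left by simp
  show "foot D (affine hull {A, B}) = A + t *\<^sub>R (B - A)"
    by (rule foot_unique[OF _ o]) (auto simp: affine_hull_2_alt)
qed

lemma foot_in:
  fixes A B D :: "real^2"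
  assumes "A \<noteq> B"
  shows "foot D (affine hull {A, B}) \<in> affine hull {A, B}"
    and "(D - foot D (affine hull {A, B})) \<bullet> (B - A) = 0"
  using foot_exists[OF assms, of D] by (metis affine_hull_2_alt rangeI)+

lemma collinear_iff_det:
  fixes A B C :: "real^2"
  shows "collinear {A, B, C} \<longleftrightarrow>
    (B$1 - A$1) * (C$2 - A$2) = (B$2 - A$2) * (C$1 - A$1)"
proof -
  have "collinear {A, B, C} \<longleftrightarrow> collinear {B, A, C}" by (simp add: insert_commute)
  also have "\<dots> \<longleftrightarrow> collinear {0, B - A, C - A}" by (rule collinear_3) (simp add: NO_MATCH_def)
  also have "\<dots> \<longleftrightarrow> (B$1 - A$1) * (C$2 - A$2) = (B$2 - A$2) * (C$1 - A$1)"
  proof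
    assume "collinear {0, B - A, C - A}"
    then have "B - A = 0 \<or> C - A = 0 \<or> (\<exists>c. C - A = c *\<^sub>R (B - A))"
      by (simp add: collinear_lemma)
    then show "(B$1 - A$1) * (C$2 - A$2) = (B$2 - A$2) * (C$1 - A$1)"
      by (auto simp: vec_eq_iff forall_2)
  next
    assume *: "(B$1 - A$1) * (C$2 - A$2) = (B$2 - A$2) * (C$1 - A$1)"
    show "collinear {0, B - A, C - A}"
    proof (cases "B - A = 0")
      case False
      then have "B$1 \<noteq> A$1 \<or> B$2 \<noteq> A$2"
        using vec_eq_iff[of B A] by (simp add: forall_2)
      then have "(B$1 - A$1)^2 + (B$2 - A$2)^2 \<noteq> 0"
        by (auto simp: sum_power2_eq_zero_iff)
      moreover have c: "(C$1 - A$1) * ((B$1 - A$1)^2 + (B$2 - A$2)^2)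
          = ((B$1 - A$1) * (C$1 - A$1) + (B$2 - A$2) * (C$2 - A$2)) * (B$1 - A$1)"
        "(C$2 - A$2) * ((B$1 - A$1)^2 + (B$2 - A$2)^2)
          = ((B$1 - A$1) * (C$1 - A$1) + (B$2 - A$2) * (C$2 - A$2)) * (B$2 - A$2)"
        using * by algebra+
      ultimately have "C - A = (((B$1 - A$1) * (C$1 - A$1) + (B$2 - A$2) * (C$2 - A$2))
          / ((B$1 - A$1)^2 + (B$2 - A$2)^2)) *\<^sub>R (B - A)"
        using c by (simp add: vec_eq_iff forall_2 eq_divide_eq)
      then show ?thesis by (auto simp: collinear_lemma)
    qed (simp add: collinear_lemma)
  qed
  finally show ?thesis .
qed

text \<open>
  A line has at most two points in common with a circle.  This is how two circles, or a circle
  and the locus of a further equation of the form \<open>m |X|\<^sup>2 + g \<bullet> X + h = 0\<close>, are compared below: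
  the difference of the equations is affine.
\<close>
lemma affine_zero_on_three_points_of_circle:
  fixes c g X Y Z W :: "real^2"
  assumes "X \<in> sphere c \<rho>" "Y \<in> sphere c \<rho>" "Z \<in> sphere c \<rho>"
    and "X \<noteq> Y" "Y \<noteq> Z" "Z \<noteq> X"
    and "g \<bullet> X + h = 0" "g \<bullet> Y + h = 0" "g \<bullet> Z + h = 0"
  shows "g \<bullet> W + h = 0"
proof -
  have "g = 0"
  proof (rule ccontr)
    assume "g \<noteq> 0"
    have "g \<bullet> (Y - X) = 0" "g \<bullet> (Z - X) = 0" using assms by (simp_all add: inner_diff_right)
    then have e: "g$1 * (Y$1 - X$1) + g$2 * (Y$2 - X$2) = 0"
      "g$1 * (Z$1 - X$1) + g$2 * (Z$2 - X$2) = 0"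
      by (simp_all add: inner_vec_def sum_2)
    have "g$1 \<noteq> 0 \<or> g$2 \<noteq> 0" using \<open>g \<noteq> 0\<close> by (auto simp: vec_eq_iff forall_2)
    moreover have "g$1 * ((Y$1 - X$1) * (Z$2 - X$2) - (Y$2 - X$2) * (Z$1 - X$1)) = 0"
      "g$2 * ((Y$1 - X$1) * (Z$2 - X$2) - (Y$2 - X$2) * (Z$1 - X$1)) = 0"
      using e by algebra+
    ultimately have "(Y$1 - X$1) * (Z$2 - X$2) = (Y$2 - X$2) * (Z$1 - X$1)" by auto
    then have "collinear {X, Y, Z}" by (simp add: collinear_iff_det)
    then have "collinear {0, Y - X, Z - X}"
      using collinear_3[of Y X Z] by (simp add: insert_commute)
    then obtain \<tau> where \<tau>: "Z - X = \<tau> *\<^sub>R (Y - X)"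
      using assms by (auto simp: collinear_lemma)
    define y w where "y = Y - X" and "w = X - c"
    have Y: "Y - c = w + y" by (simp add: y_def w_def)
    have Z: "Z - c = w + \<tau> *\<^sub>R y" unfolding y_def \<tau>[symmetric] by (simp add: w_def)
    have "norm (w + y) = norm w" "norm (w + \<tau> *\<^sub>R y) = norm w"
      using assms(1-3) unfolding Y[symmetric] Z[symmetric] unfolding w_def
      by (simp_all add: dist_norm norm_minus_commute)
    then have "(w + y) \<bullet> (w + y) = w \<bullet> w" "(w + \<tau> *\<^sub>R y) \<bullet> (w + \<tau> *\<^sub>R y) = w \<bullet> w"
      by (simp_all only: flip: power2_norm_eq_inner)
    then have q: "y \<bullet> y + 2 * (w \<bullet> y) = 0" "\<tau> * (\<tau> * (y \<bullet> y) + 2 * (w \<bullet> y)) = 0"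
      by (simp_all add: inner_add inner_commute algebra_simps)
    have "\<tau> \<noteq> 0" using \<tau> assms by auto
    with q(2) have "\<tau> * (y \<bullet> y) + 2 * (w \<bullet> y) = 0" by simp
    with q(1) have "(\<tau> - 1) * (y \<bullet> y) = 0" by algebra
    moreover have "y \<noteq> 0" using assms by (simp add: y_def)
    ultimately have "\<tau> = 1" by simp
    with \<tau> assms show False by simp
  qed
  with assms show ?thesis by simp
qed

section \<open>Tangents of a conic with given focus\<close>

lemma infdist_line:
  fixes U V :: "real^2"
  assumes "U \<noteq> V"
  obtains n where "norm n = 1" and "\<And>X. infdist X (affine hull {U, V}) = \<bar>n \<bullet> (X - U)\<bar>"
    and "\<And>X. n \<bullet> (X - U) = 0 \<Longrightarrow> X \<in> affine hull {U, V}"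
proof
  define e where "e = V - U"
  define n :: "real^2" where "n = (1 / norm e) *\<^sub>R vector [- e$2, e$1]"
  have "e \<noteq> 0" using assms by (simp add: e_def)
  have "norm (vector [- e$2, e$1] :: real^2) = norm e"
    by (simp add: norm_vec_def L2_set_def sum_2 add.commute)
  then show n: "norm n = 1" using \<open>e \<noteq> 0\<close> by (simp add: n_def)
  have ne: "n \<bullet> e = 0" by (simp add: n_def inner_vec_def sum_2)
  show on: "X \<in> affine hull {U, V}" if "n \<bullet> (X - U) = 0" for X
  proof -
    have "vector [- e$2, e$1] \<bullet> (X - U) = 0" using that \<open>e \<noteq> 0\<close> by (simp add: n_def)
    then have "(V$1 - U$1) * (X$2 - U$2) = (V$2 - U$2) * (X$1 - U$1)"
      by (simp add: inner_vec_def sum_2 e_def) algebra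
    then have "collinear {U, V, X}" by (simp add: collinear_iff_det)
    then show ?thesis using assms by (simp add: collinear_3_affine_hull)
  qed
  show "infdist X (affine hull {U, V}) = \<bar>n \<bullet> (X - U)\<bar>" for X
  proof (rule antisym)
    define Y where "Y = X - (n \<bullet> (X - U)) *\<^sub>R n"
    have "n \<bullet> n = 1" using n by (simp add: norm_eq_1)
    then have "n \<bullet> (Y - U) = 0" by (simp add: Y_def inner_diff_right)
    then have "Y \<in> affine hull {U, V}" by (rule on)
    then have "infdist X (affine hull {U, V}) \<le> dist X Y" by (rule infdist_le)
    also have "dist X Y = \<bar>n \<bullet> (X - U)\<bar>" using n by (simp add: Y_def dist_norm)
    finally show "infdist X (affine hull {U, V}) \<le> \<bar>n \<bullet> (X - U)\<bar>" .
    have "\<bar>n \<bullet> (X - U)\<bar> \<le> dist X Y" if "Y \<in> affine hull {U, V}" for Y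
    proof -
      from that obtain t where "Y = U + t *\<^sub>R e" unfolding affine_hull_2_alt e_def by blast
      then have "n \<bullet> (X - U) = n \<bullet> (X - Y)" using ne by (simp add: inner_diff_right inner_add_right)
      also have "\<bar>\<dots>\<bar> \<le> norm n * norm (X - Y)" by (rule Cauchy_Schwarz_ineq2)
      finally show ?thesis using n by (simp add: dist_norm)
    qed
    then show "\<bar>n \<bullet> (X - U)\<bar> \<le> infdist X (affine hull {U, V})"
      by (simp add: infdist_notempty cINF_greatest)
  qed
qed

text \<open>
  The square removes the absolute value from the distance to the directrix, so that circles
  (\<open>a = 0\<close>) and the other conics have a common form; \<open>b \<noteq> 0\<close> because the focus is not on the
  directrix.
\<close>
lemma conic_with_focusE:
  assumes "conic_with_focus q D"
  obtains k a b where "k \<noteq> 0" "b \<noteq> 0"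
    "\<And>X. q X = k * ((X - D) \<bullet> (X - D) - (a \<bullet> (X - D) + b)\<^sup>2)"
proof -
  from assms obtain k where "k \<noteq> 0" and
    k: "(\<exists>r>0. \<forall>X. q X = k * ((dist X D)\<^sup>2 - r\<^sup>2)) \<or>
        (\<exists>e>0. \<exists>U V. U \<noteq> V \<and> D \<notin> affine hull {U, V} \<and>
           (\<forall>X. q X = k * ((dist X D)\<^sup>2 - (e * infdist X (affine hull {U, V}))\<^sup>2)))"
    unfolding conic_with_focus_def by blast
  from k show thesis
  proof
    assume "\<exists>r>0. \<forall>X. q X = k * ((dist X D)\<^sup>2 - r\<^sup>2)"
    then obtain r where "r > 0" "\<forall>X. q X = k * ((dist X D)\<^sup>2 - r\<^sup>2)" by auto
    then show thesis using that[of k r 0] \<open>k \<noteq> 0\<close> by (simp add: dist_norm power2_norm_eq_inner)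
  next
    assume "\<exists>e>0. \<exists>U V. U \<noteq> V \<and> D \<notin> affine hull {U, V} \<and>
           (\<forall>X. q X = k * ((dist X D)\<^sup>2 - (e * infdist X (affine hull {U, V}))\<^sup>2))"
    then obtain e U V where e: "e > 0" "U \<noteq> V" "D \<notin> affine hull {U, V}"
       "\<And>X. q X = k * ((dist X D)\<^sup>2 - (e * infdist X (affine hull {U, V}))\<^sup>2)" by blast
    obtain n where n: "\<And>X. infdist X (affine hull {U, V}) = \<bar>n \<bullet> (X - U)\<bar>"
      "\<And>X. n \<bullet> (X - U) = 0 \<Longrightarrow> X \<in> affine hull {U, V}"
      using infdist_line[OF e(2)] by metis
    have "e * (n \<bullet> (D - U)) \<noteq> 0" using e n(2) by auto
    moreover have "q X = k * ((X - D) \<bullet> (X - D) - ((e *\<^sub>R n) \<bullet> (X - D) + e * (n \<bullet> (D - U)))\<^sup>2)" for X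
    proof -
      have "(e *\<^sub>R n) \<bullet> (X - D) + e * (n \<bullet> (D - U)) = e * (n \<bullet> (X - U))"
        by (simp add: inner_diff_right algebra_simps)
      then show ?thesis
        unfolding e(4) n(1) by (simp add: dist_norm power2_norm_eq_inner power_mult_distrib)
    qed
    ultimately show thesis using that \<open>k \<noteq> 0\<close> by blast
  qed
qed

lemma quadratic_coeffs_unique:
  fixes \<alpha> \<beta> \<delta> :: real
  assumes "\<And>t. \<alpha> * t^2 + \<beta> * t + \<delta> = \<alpha>' * t^2 + \<beta>' * t + \<delta>'"
  shows "\<alpha> = \<alpha>'" "\<beta> = \<beta>'" "\<delta> = \<delta>'"
  using assms[of 0] assms[of 1] assms[of "-1"] by auto

text \<open>
  Measured from the foot, the restriction of the quadratic polynomial to the line has a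
  discriminant that contains the factor \<open>|B - A|\<^sup>2\<close>; the cofactor is the right-hand side.  If it
  vanishes together with the leading coefficient, the polynomial is constant, and \<open>b \<noteq> 0\<close> keeps
  this constant from being zero: the line is an asymptote.
\<close>
lemma tangent_line_iff_foot:
  fixes q :: "real^2 \<Rightarrow> real" and D a :: "real^2"
  assumes "k \<noteq> 0" "b \<noteq> 0"
    and q: "\<And>X. q X = k * ((X - D) \<bullet> (X - D) - (a \<bullet> (X - D) + b)\<^sup>2)"
    and "A \<noteq> B"
  defines "F \<equiv> foot D (affine hull {A, B}) - D"
  shows "tangent_line q A B \<longleftrightarrow> (a \<bullet> a - 1) * (F \<bullet> F) + 2 * b * (a \<bullet> F) + b\<^sup>2 = 0"
proof -
  obtain t0 where t0: "foot D (affine hull {A, B}) = A + t0 *\<^sub>R (B - A)"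
    "(D - (A + t0 *\<^sub>R (B - A))) \<bullet> (B - A) = 0"
    using foot_exists[OF \<open>A \<noteq> B\<close>] by metis
  define e where "e = B - A"
  have Fe: "F \<bullet> e = 0" using t0 by (simp add: F_def e_def inner_diff_left inner_add_left)
  have ee: "e \<bullet> e > 0" using \<open>A \<noteq> B\<close> by (simp add: e_def)
  define v w where "v = a \<bullet> e" and "w = a \<bullet> F + b"
  have line: "q (A + t *\<^sub>R (B - A))
    = k * ((e \<bullet> e - v^2) * (t - t0)^2 - 2 * v * w * (t - t0) + (F \<bullet> F - w^2))" for t
  proof -
    have X: "A + t *\<^sub>R (B - A) - D = F + (t - t0) *\<^sub>R e"
      by (simp add: F_def t0 e_def algebra_simps)
    have "(F + (t - t0) *\<^sub>R e) \<bullet> (F + (t - t0) *\<^sub>R e) = F \<bullet> F + (t - t0)^2 * (e \<bullet> e)"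
      using Fe by (simp add: inner_add inner_commute power2_eq_square)
    moreover have "a \<bullet> (F + (t - t0) *\<^sub>R e) + b = w + (t - t0) * v"
      by (simp add: w_def v_def inner_add_right)
    ultimately show ?thesis unfolding q X by (simp only:) (simp add: algebra_simps power2_eq_square)
  qed
  \<comment> \<open>Pythagoras for \<open>a\<close> in the orthogonal directions \<open>F\<close> and \<open>e\<close>, valid also for \<open>F = 0\<close>.\<close>
  have "(a \<bullet> a) * (F \<bullet> F) * (e \<bullet> e) = (a \<bullet> F)\<^sup>2 * (e \<bullet> e) + v\<^sup>2 * (F \<bullet> F)"
    using Fe unfolding v_def by (simp add: inner_vec_def sum_2) algebra
  then have disc: "v^2 * w^2 - (e \<bullet> e - v^2) * (F \<bullet> F - w^2)
      = (e \<bullet> e) * ((a \<bullet> a - 1) * (F \<bullet> F) + 2 * b * (a \<bullet> F) + b\<^sup>2)"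
    unfolding w_def by algebra
  have "tangent_line q A B \<longleftrightarrow> v^2 * w^2 - (e \<bullet> e - v^2) * (F \<bullet> F - w^2) = 0"
  proof
    assume "tangent_line q A B"
    then obtain k' where "k' \<noteq> 0" and k': "(\<exists>s. \<forall>t. q (A + t *\<^sub>R (B - A)) = k' * (t - s)\<^sup>2) \<or>
        (\<forall>t. q (A + t *\<^sub>R (B - A)) = k')" unfolding tangent_line_def by auto
    from k' show "v^2 * w^2 - (e \<bullet> e - v^2) * (F \<bullet> F - w^2) = 0"
    proof
      assume "\<exists>s. \<forall>t. q (A + t *\<^sub>R (B - A)) = k' * (t - s)\<^sup>2"
      then obtain s where s: "\<And>t. q (A + t *\<^sub>R (B - A)) = k' * (t - s)\<^sup>2" by auto
      have *: "(k * (e \<bullet> e - v^2)) * t^2 + (- (2 * k * v * w)) * t + k * (F \<bullet> F - w^2)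
          = k' * t^2 + (2 * k' * (t0 - s)) * t + k' * (t0 - s)^2" for t
        using line[of "t + t0"] s[of "t + t0"] by (simp add: algebra_simps power2_eq_square)
      have "k^2 * (v^2 * w^2 - (e \<bullet> e - v^2) * (F \<bullet> F - w^2)) = 0"
      proof -
        have "(2 * k * v * w)^2 = (2 * k' * (t0 - s))^2"
          using quadratic_coeffs_unique(2)[OF *] by (metis power2_minus)
        also have "\<dots> = 4 * k' * (k' * (t0 - s)^2)" by (simp add: power2_eq_square)
        also have "\<dots> = 4 * (k * (e \<bullet> e - v^2)) * (k * (F \<bullet> F - w^2))"
          using quadratic_coeffs_unique(1,3)[OF *] by simp
        finally show ?thesis by algebra
      qed
      then show ?thesis using \<open>k \<noteq> 0\<close> by simp
    next
      assume s: "\<forall>t. q (A + t *\<^sub>R (B - A)) = k'"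
      have *: "(k * (e \<bullet> e - v^2)) * t^2 + (- (2 * k * v * w)) * t + k * (F \<bullet> F - w^2)
          = 0 * t^2 + 0 * t + k'" for t
        using line[of "t + t0"] s[rule_format, of "t + t0"] by (simp add: algebra_simps power2_eq_square)
      show ?thesis using quadratic_coeffs_unique[OF *] \<open>k \<noteq> 0\<close> by auto
    qed
  next
    assume d0: "v^2 * w^2 - (e \<bullet> e - v^2) * (F \<bullet> F - w^2) = 0"
    \<comment> \<open>A vanishing leading coefficient means contact at infinity.\<close>
    show "tangent_line q A B"
    proof (cases "e \<bullet> e - v^2 = 0")
      case True
      then have "v \<noteq> 0" using ee by auto
      with d0 True have w: "w = 0" by simp
      have "F \<noteq> 0" using w \<open>b \<noteq> 0\<close> by (auto simp: w_def)
      then have "k * (F \<bullet> F) \<noteq> 0" using \<open>k \<noteq> 0\<close> by simp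
      moreover have "\<forall>t. q (A + t *\<^sub>R (B - A)) = k * (F \<bullet> F)" using line True w by simp
      ultimately show ?thesis using \<open>A \<noteq> B\<close> unfolding tangent_line_def by blast
    next
      case False
      define L where "L = e \<bullet> e - v^2"
      define G where "G = F \<bullet> F - w^2"
      have L: "L \<noteq> 0" and d1: "v^2 * w^2 = L * G" using False d0 by (auto simp: L_def G_def)
      have "q (A + t *\<^sub>R (B - A)) = k * L * (t - (t0 + v * w / L))^2" for t
      proof -
        have "L * (L * (t - t0)^2 - 2 * v * w * (t - t0) + G) = (L * (t - t0) - v * w)^2"
          using d1 by algebra
        also have "\<dots> = L * (L * (t - (t0 + v * w / L))^2)"
          using L by (simp add: field_simps power2_eq_square)
        finally have "L * (t - t0)^2 - 2 * v * w * (t - t0) + G = L * (t - (t0 + v * w / L))^2"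
          using L by simp
        then show ?thesis unfolding line by (simp add: L_def G_def)
      qed
      moreover have "k * L \<noteq> 0" using L \<open>k \<noteq> 0\<close> by simp
      ultimately show ?thesis using \<open>A \<noteq> B\<close> unfolding tangent_line_def by blast
    qed
  qed
  also have "\<dots> \<longleftrightarrow> (a \<bullet> a - 1) * (F \<bullet> F) + 2 * b * (a \<bullet> F) + b\<^sup>2 = 0"
    unfolding disc using ee by simp
  finally show ?thesis .
qed

lemma feet_of_sides_distinct:
  fixes X Y Z D :: "real^2"
  assumes "\<not> collinear {X, Y, Z}" and "D \<notin> affine hull {X, Y}"
  shows "foot D (affine hull {X, Y}) \<noteq> foot D (affine hull {X, Z})"
proof
  define F where "F = foot D (affine hull {X, Y})"
  assume eq: "foot D (affine hull {X, Y}) = foot D (affine hull {X, Z})"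
  have ne: "X \<noteq> Y" "X \<noteq> Z" using assms(1) by (auto simp: insert_commute)
  have "(D - F) \<bullet> (Y - X) = 0" "(D - F) \<bullet> (Z - X) = 0" and F: "F \<in> affine hull {X, Y}"
    using foot_in[OF ne(1), of D] foot_in[OF ne(2), of D] eq by (simp_all add: F_def)
  then have e: "(D$1 - F$1) * (Y$1 - X$1) + (D$2 - F$2) * (Y$2 - X$2) = 0"
    "(D$1 - F$1) * (Z$1 - X$1) + (D$2 - F$2) * (Z$2 - X$2) = 0"
    by (simp_all add: inner_vec_def sum_2)
  have "(D$1 - F$1) * ((Y$1 - X$1) * (Z$2 - X$2) - (Y$2 - X$2) * (Z$1 - X$1)) = 0"
    "(D$2 - F$2) * ((Y$1 - X$1) * (Z$2 - X$2) - (Y$2 - X$2) * (Z$1 - X$1)) = 0"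
    using e by algebra+
  then have "D$1 = F$1" "D$2 = F$2" using assms(1) by (simp_all add: collinear_iff_det)
  then have "D = F" by (simp add: vec_eq_iff forall_2)
  with F assms(2) show False by simp
qed

text \<open>
  The equation \<open>N X = 0\<close> for the feet on tangents and \<open>m\<close> times the equation of the pedal circle
  differ by an affine function, which vanishes at the three feet and therefore everywhere.
  Since \<open>N D = b\<^sup>2 \<noteq> 0\<close>, it follows that \<open>m \<noteq> 0\<close> (the conic is not a parabola) and that \<open>D\<close> is
  not on the pedal circle.
\<close>
lemma tangent_line_iff_foot_on_pedal_circle:
  fixes P Q R D :: "real^2"
  assumes nc: "\<not> collinear {P, Q, R}"
    and nD: "D \<notin> affine hull {P, Q}" "D \<notin> affine hull {Q, R}" "D \<notin> affine hull {R, P}"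
    and E: "is_pedal_circle E P Q R D" and \<gamma>: "is_i_conic \<gamma> P Q R D"
  shows "D \<notin> E"
    and "A \<noteq> B \<Longrightarrow> tangent_line \<gamma> A B \<longleftrightarrow> foot D (affine hull {A, B}) \<in> E"
proof -
  define F1 where "F1 = foot D (affine hull {P, Q})"
  define F2 where "F2 = foot D (affine hull {Q, R})"
  define F3 where "F3 = foot D (affine hull {R, P})"
  have ncs: "\<not> collinear {Q, R, P}" "\<not> collinear {R, P, Q}" "P \<noteq> Q" "Q \<noteq> R" "R \<noteq> P"
    using nc by (auto simp: insert_commute)
  have dist: "F1 \<noteq> F2" "F2 \<noteq> F3" "F3 \<noteq> F1"
    using feet_of_sides_distinct[of P Q R D] feet_of_sides_distinct[of Q R P D]
      feet_of_sides_distinct[of R P Q D] nc ncs nD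
    by (simp_all add: F1_def F2_def F3_def insert_commute)
  obtain c \<rho> where c: "E = sphere c \<rho>"
    using E by (auto simp: is_pedal_circle_def is_circumcircle_def)
  have onE: "F1 \<in> sphere c \<rho>" "F2 \<in> sphere c \<rho>" "F3 \<in> sphere c \<rho>"
    using E c by (auto simp: is_pedal_circle_def is_circumcircle_def F1_def F2_def F3_def)
  have "conic_with_focus \<gamma> D" using \<gamma> by (simp add: is_i_conic_def)
  then obtain k a b where kb: "k \<noteq> 0" "b \<noteq> 0"
    and q: "\<And>X. \<gamma> X = k * ((X - D) \<bullet> (X - D) - (a \<bullet> (X - D) + b)\<^sup>2)"
    by (rule conic_with_focusE) blast
  define N where "N X = (a \<bullet> a - 1) * ((X - D) \<bullet> (X - D)) + 2 * b * (a \<bullet> (X - D)) + b\<^sup>2" for X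
  have tan: "tangent_line \<gamma> A B \<longleftrightarrow> N (foot D (affine hull {A, B})) = 0" if "A \<noteq> B" for A B
    unfolding N_def by (rule tangent_line_iff_foot[OF kb q that])
  have N0: "N F1 = 0" "N F2 = 0" "N F3 = 0"
    using \<gamma> tan[of P Q] tan[of Q R] tan[of R P] ncs
    unfolding is_i_conic_def circumscribed_def F1_def F2_def F3_def by blast+
  define m where "m = a \<bullet> a - 1"
  define g where "g = (2 * m) *\<^sub>R (c - D) + (2 * b) *\<^sub>R a"
  define h where "h = m * (D \<bullet> D - c \<bullet> c + \<rho>\<^sup>2) - 2 * b * (a \<bullet> D) + b\<^sup>2"
  have aff: "N X = m * ((X - c) \<bullet> (X - c) - \<rho>\<^sup>2) + (g \<bullet> X + h)" for X
    unfolding N_def g_def h_def m_def[symmetric]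
    by (simp add: inner_diff inner_add inner_commute algebra_simps)
  have "\<rho> \<ge> 0" using onE(1) by (auto simp: sphere_def)
  then have circ: "X \<in> sphere c \<rho> \<longleftrightarrow> (X - c) \<bullet> (X - c) - \<rho>\<^sup>2 = 0" for X
    by (simp add: dist_norm norm_minus_commute power2_eq_iff_nonneg flip: power2_norm_eq_inner)
  have "g \<bullet> X + h = 0" if "X \<in> sphere c \<rho>" "N X = 0" for X
    using aff[of X] that by (simp only: circ mult_zero_right add_0_left)
  then have "g \<bullet> X + h = 0" for X
    using affine_zero_on_three_points_of_circle[OF onE dist] N0 onE by blast
  then have N: "N X = m * ((X - c) \<bullet> (X - c) - \<rho>\<^sup>2)" for X
    using aff[of X] by (simp only: add_0_right)
  have ND: "N D \<noteq> 0" using kb by (simp add: N_def)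
  then have "m \<noteq> 0" unfolding N by auto
  then have NE: "N X = 0 \<longleftrightarrow> X \<in> E" for X
    unfolding N c circ by simp
  show "D \<notin> E" using ND NE by simp
  show "A \<noteq> B \<Longrightarrow> tangent_line \<gamma> A B \<longleftrightarrow> foot D (affine hull {A, B}) \<in> E"
    using tan NE by simp
qed

section \<open>The porism in the plane\<close>

definition plane_to_complex :: "real^2 \<Rightarrow> real \<Rightarrow> real^2 \<Rightarrow> complex" where
  "plane_to_complex ctr r X = Complex ((X$1 - ctr$1) / r) ((X$2 - ctr$2) / r)"

lemma cmod_plane_to_complex_diff:
  assumes "r > 0"
  shows "cmod (plane_to_complex ctr r X - plane_to_complex ctr r Y) = dist X Y / r"
proof -
  have "cmod (plane_to_complex ctr r X - plane_to_complex ctr r Y)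
      = sqrt (((X$1 - Y$1)^2 + (X$2 - Y$2)^2) / r^2)"
    by (simp add: plane_to_complex_def cmod_def power_divide add_divide_distrib flip: diff_divide_distrib)
  also have "\<dots> = dist X Y / r"
    using assms by (simp add: real_sqrt_divide dist_vec_def L2_set_def sum_2 dist_real_def)
  finally show ?thesis .
qed

lemma Re_plane_to_complex_mult_cnj:
  fixes ctr :: "real^2" and r :: real
  defines "\<phi> \<equiv> plane_to_complex ctr r"
  shows "Re ((\<phi> X - \<phi> Y) * cnj (\<phi> Z - \<phi> W)) = ((X - Y) \<bullet> (Z - W)) / r^2"
proof -
  have "\<phi> S - \<phi> T = Complex ((S$1 - T$1) / r) ((S$2 - T$2) / r)" for S T
    by (simp add: \<phi>_def plane_to_complex_def complex_eq_iff flip: diff_divide_distrib)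
  then show ?thesis
    by (simp add: inner_vec_def sum_2 power2_eq_square flip: add_divide_distrib)
qed

lemma plane_to_complex_on_circle:
  assumes "r > 0"
  shows "X \<in> sphere ctr r \<longleftrightarrow> cmod (plane_to_complex ctr r X) = 1"
proof -
  have "plane_to_complex ctr r ctr = 0" by (simp add: plane_to_complex_def complex_eq_iff)
  then show ?thesis
    using cmod_plane_to_complex_diff[OF assms, of ctr X ctr] assms by (auto simp: dist_commute)
qed

lemma cnj_unit: "cmod z = 1 \<Longrightarrow> cnj z * z = 1"
  by (metis complex_norm_square mult.commute of_real_1 one_power2)

lemma foot_on_chord:
  fixes A B D ctr :: "real^2"
  assumes "r > 0" "A \<in> sphere ctr r" "B \<in> sphere ctr r" "A \<noteq> B"
  defines "\<phi> \<equiv> plane_to_complex ctr r"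
  shows "2 * \<phi> (foot D (affine hull {A, B})) = \<phi> D + \<phi> A + \<phi> B - \<phi> A * \<phi> B * cnj (\<phi> D)"
proof -
  obtain t where t: "foot D (affine hull {A, B}) = A + t *\<^sub>R (B - A)"
    "(D - (A + t *\<^sub>R (B - A))) \<bullet> (B - A) = 0"
    using foot_exists[OF \<open>A \<noteq> B\<close>] by metis
  define u v d F where "u = \<phi> A" and "v = \<phi> B" and "d = \<phi> D" and "F = \<phi> (foot D (affine hull {A, B}))"
  have F: "F = u + of_real t * (v - u)"
    unfolding F_def u_def v_def t \<phi>_def plane_to_complex_def using \<open>r > 0\<close>
    by (simp add: complex_eq_iff field_simps)
  have "Re ((d - F) * cnj (v - u)) = 0"
  proof -
    have "Re ((d - F) * cnj (v - u)) = ((D - (A + t *\<^sub>R (B - A))) \<bullet> (B - A)) / r^2"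
      unfolding F_def u_def v_def d_def t(1) \<phi>_def by (rule Re_plane_to_complex_mult_cnj)
    then show ?thesis using t(2) by simp
  qed
  then have "(d - F) * cnj (v - u) + cnj ((d - F) * cnj (v - u)) = 0"
    by (simp only: complex_add_cnj) simp
  then have perp: "(d - F) * (cnj v - cnj u) + (cnj d - cnj F) * (v - u) = 0" by simp
  have cF: "cnj F = cnj u + of_real t * (cnj v - cnj u)" by (simp add: F)
  have u: "cnj u * u = 1" and v: "cnj v * v = 1"
    using assms cnj_unit plane_to_complex_on_circle unfolding u_def v_def \<phi>_def by blast+
  have "u \<noteq> v"
    using cmod_plane_to_complex_diff[OF \<open>r > 0\<close>, of ctr A B] assms by (auto simp: u_def v_def)
  \<comment> \<open>On the unit circle conjugation is inversion, so the equations \<open>F + u v F' = u + v\<close> of the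
    chord and \<open>d - F = u v (d' - F')\<close> of the perpendicular are linear in \<open>F\<close> and \<open>F'\<close>.\<close>
  have "(cnj v - cnj u) * (u * v) = (cnj v * v) * u - (cnj u * u) * v"
    by (simp add: algebra_simps)
  then have uv: "(cnj v - cnj u) * (u * v) = u - v" using u v by simp
  have "cnj u * (u * v) = v" using u by (simp add: mult.assoc[symmetric])
  then have "cnj F * (u * v) = v + of_real t * (u - v)"
    unfolding cF distrib_right mult.assoc uv by simp
  then have chord: "F + cnj F * (u * v) = u + v" unfolding F by (simp add: algebra_simps)
  have "(u - v) * (d - F - (cnj d - cnj F) * (u * v)) =
      (d - F) * ((cnj v - cnj u) * (u * v)) + (cnj d - cnj F) * (v - u) * (u * v)"
    unfolding uv by (simp add: algebra_simps)
  also have "\<dots> = ((d - F) * (cnj v - cnj u) + (cnj d - cnj F) * (v - u)) * (u * v)"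
    by (simp add: algebra_simps)
  finally have "d - F = (cnj d - cnj F) * (u * v)" using perp \<open>u \<noteq> v\<close> by simp
  then have "2 * F = d + u + v - u * v * cnj d"
    using chord by algebra
  then show ?thesis unfolding u_def v_def d_def F_def .
qed

lemma foot_on_sphere_iff_pedal_rel:
  fixes A B D ctr :: "real^2"
  assumes "r > 0" "\<rho> \<ge> 0" "A \<in> sphere ctr r" "B \<in> sphere ctr r" "A \<noteq> B"
  defines "\<phi> \<equiv> plane_to_complex ctr r"
  shows "foot D (affine hull {A, B}) \<in> sphere c \<rho> \<longleftrightarrow>
     pedal_rel (\<phi> D) (2 * \<phi> c - \<phi> D) (of_real ((2 * \<rho> / r)^2)) (\<phi> A) (\<phi> B)"
proof -
  define u v d f where "u = \<phi> A" and "v = \<phi> B" and "d = \<phi> D" and "f = 2 * \<phi> c - \<phi> D"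
  define G where "G = u + v - u * v * cnj d - f"
  have u: "cnj u * u = 1" and v: "cnj v * v = 1"
    using assms cnj_unit plane_to_complex_on_circle unfolding u_def v_def \<phi>_def by blast+
  have "2 * (\<phi> (foot D (affine hull {A, B})) - \<phi> c) = G"
    using foot_on_chord[OF assms(1,3,4,5), of D] unfolding G_def u_def v_def d_def f_def \<phi>_def
    by (simp add: algebra_simps)
  then have "cmod G = 2 * (dist (foot D (affine hull {A, B})) c / r)"
    using cmod_plane_to_complex_diff[OF \<open>r > 0\<close>, of ctr _ c]
    by (metis \<phi>_def norm_mult norm_numeral)
  then have "foot D (affine hull {A, B}) \<in> sphere c \<rho> \<longleftrightarrow> cmod G = 2 * \<rho> / r"
    using \<open>r > 0\<close> by (auto simp: dist_commute)
  also have "\<dots> \<longleftrightarrow> (cmod G)^2 = (2 * \<rho> / r)^2"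
    using assms by (auto simp: power2_eq_iff_nonneg)
  also have "\<dots> \<longleftrightarrow> G * cnj G = of_real ((2 * \<rho> / r)^2)"
    by (metis complex_norm_square of_real_eq_iff)
  also have "\<dots> \<longleftrightarrow> G * (cnj G * (u * v)) = of_real ((2 * \<rho> / r)^2) * (u * v)"
    using u v by auto
  also have "cnj G * (u * v) = u + v - d - u * v * cnj f"
  proof -
    have "cnj G * (u * v) = (cnj u * u) * v + (cnj v * v) * u - (cnj u * u) * (cnj v * v) * d - u * v * cnj f"
      by (simp add: G_def algebra_simps)
    then show ?thesis unfolding u v by simp
  qed
  finally show ?thesis unfolding pedal_rel_def G_def u_def v_def d_def f_def .
qed

text \<open>
  The closing step needs \<open>w\<close> different from \<open>d\<close> and \<open>f\<close>.  Neither of them is on the unit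
  circle: \<open>d\<close> by assumption, and if \<open>f\<close> were, then the value of \<open>M\<close> would become \<open>|d - f|\<^sup>2\<close>, which
  puts \<open>D\<close> on the circle with centre \<open>c\<close>.
\<close>
lemma poncelet_closure:
  fixes ctr D c :: "real^2"
  assumes "r > 0" "\<rho> \<ge> 0" and "D \<notin> sphere ctr r" and "D \<notin> sphere c \<rho>"
    and P: "P \<in> sphere ctr r" "Q \<in> sphere ctr r" "R \<in> sphere ctr r" "P \<noteq> Q" "Q \<noteq> R" "R \<noteq> P"
    and feet: "foot D (affine hull {P, Q}) \<in> sphere c \<rho>" "foot D (affine hull {Q, R}) \<in> sphere c \<rho>"
      "foot D (affine hull {R, P}) \<in> sphere c \<rho>"
    and A: "A \<in> sphere ctr r" "B \<in> sphere ctr r" "C \<in> sphere ctr r" "A \<noteq> B" "C \<noteq> B" "C \<noteq> A"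
    and CA: "foot D (affine hull {C, A}) \<in> sphere c \<rho>" and CB: "foot D (affine hull {C, B}) \<in> sphere c \<rho>"
  shows "foot D (affine hull {A, B}) \<in> sphere c \<rho>"
proof -
  define \<phi> where "\<phi> = plane_to_complex ctr r"
  define d f M where "d = \<phi> D" and "f = 2 * \<phi> c - \<phi> D" and "M = complex_of_real ((2 * \<rho> / r)^2)"
  have rel: "foot D (affine hull {X, Y}) \<in> sphere c \<rho> \<longleftrightarrow> pedal_rel d f M (\<phi> X) (\<phi> Y)"
    if "X \<in> sphere ctr r" "Y \<in> sphere ctr r" "X \<noteq> Y" for X Y
    unfolding d_def f_def M_def \<phi>_def by (rule foot_on_sphere_iff_pedal_rel[OF assms(1,2) that])
  have inj: "\<phi> X \<noteq> \<phi> Y" if "X \<noteq> Y" for X Y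
    using cmod_plane_to_complex_diff[OF \<open>r > 0\<close>, of ctr X Y] that \<open>r > 0\<close> by (auto simp: \<phi>_def)
  have unit: "cmod (\<phi> X) = 1 \<longleftrightarrow> X \<in> sphere ctr r" for X
    using plane_to_complex_on_circle[OF \<open>r > 0\<close>] by (simp add: \<phi>_def)
  have "\<phi> R \<noteq> 0" using unit[of R] P by auto
  have M: "M = (1 - cnj d * f) * (1 - d * cnj f)"
    using porism_condition[OF inj[OF P(4)] inj[OF P(5)] inj[OF P(6)] \<open>\<phi> R \<noteq> 0\<close>] feet rel P by blast
  have d1: "cmod d \<noteq> 1" using unit assms(3) by (simp add: d_def)
  have f1: "cmod f \<noteq> 1"
  proof
    assume "cmod f = 1"
    then have f: "cnj f * f = 1" by (rule cnj_unit)
    have "(1 - cnj d * f) * (1 - d * cnj f) - (1 - cnj f * f) * (1 - cnj d * d) = (d - f) * cnj (d - f)"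
      by (simp add: algebra_simps)
    then have "M = (d - f) * cnj (d - f)" unfolding M f by simp
    then have "(cmod (d - f))^2 = (2 * \<rho> / r)^2"
      unfolding M_def by (metis complex_norm_square of_real_eq_iff)
    then have "cmod (d - f) = 2 * \<rho> / r"
      using assms(1,2) by (simp add: power2_eq_iff_nonneg)
    moreover have "d - f = 2 * (\<phi> D - \<phi> c)" by (simp add: d_def f_def)
    ultimately have "cmod (\<phi> D - \<phi> c) = \<rho> / r" by (simp only: norm_mult norm_numeral)
    then have "dist D c = \<rho>"
      using cmod_plane_to_complex_diff[OF \<open>r > 0\<close>, of ctr D c] \<open>r > 0\<close> by (simp add: \<phi>_def)
    with assms(4) show False by (simp add: dist_commute)
  qed
  have nz: "1 - \<phi> C * cnj z \<noteq> 0" if "cmod z \<noteq> 1" for z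
  proof
    assume "1 - \<phi> C * cnj z = 0"
    then have "cmod (\<phi> C) * cmod z = 1" by (metis complex_mod_cnj eq_iff_diff_eq_0 norm_mult norm_one)
    with that unit[of C] A show False by simp
  qed
  have "pedal_rel d f M (\<phi> A) (\<phi> B)"
    using porism_closes[OF _ _ inj[OF A(4)] M nz[OF d1] nz[OF f1]] rel A CA CB by blast
  then show ?thesis using rel A by blast
qed

lemma sphere_diameter_iff:
  fixes C D X :: "real^2"
  shows "X \<in> sphere (midpoint C D) (dist C D / 2) \<longleftrightarrow> (X - C) \<bullet> (X - D) = 0"
proof -
  have m: "midpoint C D - X = (1/2) *\<^sub>R ((C - X) + (D - X))"
    by (simp add: midpoint_def vec_eq_iff field_simps)
  have "X \<in> sphere (midpoint C D) (dist C D / 2) \<longleftrightarrow> norm ((C - X) + (D - X)) = norm ((C - X) - (D - X))"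
    by (simp add: dist_norm m)
  also have "\<dots> \<longleftrightarrow> ((C - X) + (D - X)) \<bullet> ((C - X) + (D - X)) = ((C - X) - (D - X)) \<bullet> ((C - X) - (D - X))"
    by (simp only: norm_eq)
  also have "\<dots> \<longleftrightarrow> (C - X) \<bullet> (D - X) = 0"
  proof -
    have "(p + q) \<bullet> (p + q) = (p - q) \<bullet> (p - q) \<longleftrightarrow> p \<bullet> q = 0" for p q :: "real^2"
      by (simp add: inner_add inner_diff inner_commute)
    then show ?thesis .
  qed
  also have "\<dots> \<longleftrightarrow> (X - C) \<bullet> (X - D) = 0"
    by (simp add: inner_diff inner_commute algebra_simps)
  finally show ?thesis .
qed

lemma foot_from_diameter_circle:
  fixes C D T B :: "real^2"
  assumes "(T - C) \<bullet> (T - D) = 0" "T \<noteq> C" "B \<in> affine hull {C, T}" "B \<noteq> C"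
  shows "foot D (affine hull {C, B}) = T"
proof -
  obtain t where t: "B = C + t *\<^sub>R (T - C)"
    using assms(3) unfolding affine_hull_2_alt by blast
  have t0: "t \<noteq> 0" using t assms(4) by auto
  have "T = C + (1 / t) *\<^sub>R (B - C)" using t t0 by simp
  then have "T \<in> affine hull {C, B}" unfolding affine_hull_2_alt by blast
  moreover have "(D - T) \<bullet> (T - C) = 0"
    using assms(1) by (simp add: inner_diff inner_commute algebra_simps)
  then have "(D - T) \<bullet> (B - C) = 0" by (simp add: t)
  ultimately show ?thesis by (rule foot_unique)
qed

text \<open>
  Both feet lie on the circle with diameter \<open>CD\<close>.  A third point common to this circle and \<open>E\<close>
  would make their equations agree, although \<open>D\<close> is on the former but not on \<open>E\<close>.
\<close>
lemma construction_of_triangle: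
  fixes A B C D :: "real^2"
  assumes E: "E = sphere c \<rho>" and "D \<notin> E"
    and nc: "\<not> collinear {A, B, C}" and K: "A \<in> K" "B \<in> K" "C \<in> K"
    and F: "foot D (affine hull {C, B}) \<in> E" "foot D (affine hull {C, A}) \<in> E"
    and nC: "foot D (affine hull {C, B}) \<noteq> C" "foot D (affine hull {C, A}) \<noteq> C"
  shows "construction K E D C A B"
proof -
  define S where "S = sphere (midpoint C D) (dist C D / 2)"
  define FB FA where "FB = foot D (affine hull {C, B})" and "FA = foot D (affine hull {C, A})"
  have ne: "C \<noteq> A" "C \<noteq> B" using nc by (auto simp: insert_commute)
  have onS: "foot D (affine hull {C, X}) \<in> S" if "C \<noteq> X" for X
  proof -
    obtain t where t: "foot D (affine hull {C, X}) = C + t *\<^sub>R (X - C)"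
      "(D - (C + t *\<^sub>R (X - C))) \<bullet> (X - C) = 0"
      using foot_exists[OF \<open>C \<noteq> X\<close>] by metis
    define G where "G = C + t *\<^sub>R (X - C)"
    have GC: "G - C = t *\<^sub>R (X - C)" by (simp add: G_def)
    have "(D - G) \<bullet> (X - C) = 0" using t(2) by (simp add: G_def)
    then have "(G - C) \<bullet> (G - D) = 0" unfolding GC by (simp add: inner_diff inner_commute)
    then show ?thesis unfolding S_def sphere_diameter_iff t(1) G_def .
  qed
  have on_line: "X \<in> affine hull {C, foot D (affine hull {C, X})}"
    if "C \<noteq> X" "foot D (affine hull {C, X}) \<noteq> C" for X
  proof -
    obtain t where t: "foot D (affine hull {C, X}) = C + t *\<^sub>R (X - C)"
      using foot_exists[OF \<open>C \<noteq> X\<close>] by metis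
    then have "t \<noteq> 0" using that by auto
    then have "X = C + (1 / t) *\<^sub>R (foot D (affine hull {C, X}) - C)" using t by simp
    then show ?thesis unfolding affine_hull_2_alt by blast
  qed
  have D: "D \<notin> affine hull {C, B}"
  proof
    assume "D \<in> affine hull {C, B}"
    then have "foot D (affine hull {C, B}) = D" by (rule foot_unique) simp
    with F \<open>D \<notin> E\<close> show False by simp
  qed
  have "FB \<noteq> FA"
    using feet_of_sides_distinct[of C B A D] D nc by (simp add: FB_def FA_def insert_commute)
  have "S \<inter> E = {FA, FB}"
  proof (intro equalityI subsetI)
    fix X assume X: "X \<in> S \<inter> E"
    show "X \<in> {FA, FB}"
    proof (rule ccontr)
      assume "X \<notin> {FA, FB}"
      define g where "g = 2 *\<^sub>R c - C - D"
      define h where "h = C \<bullet> D - c \<bullet> c + \<rho>\<^sup>2"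
      have aff: "g \<bullet> Y + h = (Y - C) \<bullet> (Y - D) - ((Y - c) \<bullet> (Y - c) - \<rho>\<^sup>2)" for Y
        unfolding g_def h_def by (simp add: inner_diff inner_add inner_commute algebra_simps)
      have z: "g \<bullet> Y + h = 0" if "Y \<in> S" "Y \<in> sphere c \<rho>" for Y
        unfolding aff using that unfolding S_def sphere_diameter_iff
        by (auto simp: dist_norm norm_minus_commute simp flip: power2_norm_eq_inner)
      have "g \<bullet> D + h = 0"
        by (rule affine_zero_on_three_points_of_circle[of FA c \<rho> FB X])
          (use z onS[OF ne(1)] onS[OF ne(2)] F E X \<open>X \<notin> {FA, FB}\<close> \<open>FB \<noteq> FA\<close> in
            \<open>auto simp: FA_def FB_def\<close>)
      then have "(norm (D - c))\<^sup>2 = \<rho>\<^sup>2" unfolding aff by (simp add: power2_norm_eq_inner)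
      moreover have "\<rho> \<ge> 0" using X E by (auto simp: sphere_def)
      ultimately have "D \<in> E" by (simp add: E dist_norm norm_minus_commute)
      with \<open>D \<notin> E\<close> show False ..
    qed
  qed (use onS[OF ne(1)] onS[OF ne(2)] F in \<open>auto simp: FA_def FB_def\<close>)
  then show ?thesis
    unfolding construction_def S_def[symmetric]
    using K nC ne on_line[OF ne(1)] on_line[OF ne(2)] \<open>FB \<noteq> FA\<close>
    by (intro conjI exI[of _ FA] exI[of _ FB]) (auto simp: FA_def FB_def)
qed

text \<open>
  If the foot were \<open>C\<close>, then \<open>DA\<close> would be the hypotenuse of a right triangle with leg \<open>DC\<close>.
\<close>
lemma foot_ne_farthest:
  fixes A C D :: "real^2"
  assumes "C \<noteq> A" "dist D A \<le> dist D C"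
  shows "foot D (affine hull {C, A}) \<noteq> C"
proof
  assume "foot D (affine hull {C, A}) = C"
  then have o: "(D - C) \<bullet> (A - C) = 0" using foot_in(2)[OF assms(1), of D] by simp
  have "(D - A) \<bullet> (D - A) = (D - C) \<bullet> (D - C) + (A - C) \<bullet> (A - C)"
    using o by (simp add: inner_diff inner_commute algebra_simps)
  moreover have "(A - C) \<bullet> (A - C) > 0" using assms by simp
  ultimately have "(D - C) \<bullet> (D - C) < (D - A) \<bullet> (D - A)" by linarith
  then have "norm (D - C) < norm (D - A)" by (simp add: norm_lt)
  with assms show False by (simp add: dist_norm)
qed

theorem mainTheorem2:
  fixes P Q R D :: "real^2"
    and K E :: "(real^2) set"
    and \<gamma> :: "real^2 \<Rightarrow> real"
  assumes "\<not> collinear {P, Q, R}"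
    and "is_circumcircle K P Q R"
    and "D \<notin> affine hull {P, Q}" and "D \<notin> affine hull {Q, R}" and "D \<notin> affine hull {R, P}"
    and "D \<notin> K"
    and "is_pedal_circle E P Q R D"
    and "is_i_conic \<gamma> P Q R D"
  shows "(\<forall>C A B. construction K E D C A B \<longrightarrow>
            tangent_line \<gamma> A B \<and> foot D (affine hull {A, B}) \<in> E) \<and>
         (\<forall>X Y Z. poristic_triangle K \<gamma> X Y Z \<longrightarrow>
            (\<exists>A B C. {A, B, C} = {X, Y, Z} \<and> construction K E D C A B))"
proof -
  note tan = tangent_line_iff_foot_on_pedal_circle[OF assms(1,3,4,5,7,8)]
  obtain ctr r where K: "K = sphere ctr r" "r > 0" and PK: "P \<in> K" "Q \<in> K" "R \<in> K"
    using assms(2) by (auto simp: is_circumcircle_def)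
  obtain c \<rho> where E: "E = sphere c \<rho>" "\<rho> > 0"
    using assms(7) by (auto simp: is_pedal_circle_def is_circumcircle_def)
  have feet: "foot D (affine hull {P, Q}) \<in> E" "foot D (affine hull {Q, R}) \<in> E"
    "foot D (affine hull {R, P}) \<in> E"
    using assms(7) by (simp_all add: is_pedal_circle_def is_circumcircle_def)
  have PQR: "P \<noteq> Q" "Q \<noteq> R" "R \<noteq> P" using assms(1) by (auto simp: insert_commute)
  show ?thesis
  proof (intro conjI allI impI)
    fix C A B assume con: "construction K E D C A B"
    then obtain TA TB where "TA \<noteq> TB"
      and I: "sphere (midpoint C D) (dist C D / 2) \<inter> E = {TA, TB}"
      and T: "TA \<noteq> C" "TB \<noteq> C" "B \<in> affine hull {C, TA}" "B \<noteq> C" "A \<in> affine hull {C, TB}" "A \<noteq> C"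
      and ABK: "A \<in> K" "B \<in> K" "C \<in> K"
      unfolding construction_def by blast
    have S: "(TA - C) \<bullet> (TA - D) = 0" "(TB - C) \<bullet> (TB - D) = 0" "TA \<in> E" "TB \<in> E"
      using I unfolding sphere_diameter_iff[symmetric] by blast+
    have f: "foot D (affine hull {C, B}) = TA" "foot D (affine hull {C, A}) = TB"
      using foot_from_diameter_circle S T by blast+
    then have "A \<noteq> B" using \<open>TA \<noteq> TB\<close> by auto
    have fE: "foot D (affine hull {C, A}) \<in> E" "foot D (affine hull {C, B}) \<in> E"
      using f S by simp_all
    have "foot D (affine hull {A, B}) \<in> sphere c \<rho>"
      by (rule poncelet_closure[OF K(2) less_imp_le[OF E(2)] assms(6)[unfolded K(1)]
            tan(1)[unfolded E(1)] PK[unfolded K(1)] PQR feet[unfolded E(1)] ABK[unfolded K(1)]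
            \<open>A \<noteq> B\<close> not_sym[OF T(4)] not_sym[OF T(6)] fE[unfolded E(1)]])
    then show "foot D (affine hull {A, B}) \<in> E" by (simp add: E)
    then show "tangent_line \<gamma> A B" using tan(2) \<open>A \<noteq> B\<close> by blast
  next
    fix X Y Z assume por: "poristic_triangle K \<gamma> X Y Z"
    have main: "\<exists>A B C. {A, B, C} = {X, Y, Z} \<and> construction K E D C A B"
      if ABC: "{A, B, C} = {X, Y, Z}" and far: "dist D A \<le> dist D C" "dist D B \<le> dist D C"
        and t: "tangent_line \<gamma> C A" "tangent_line \<gamma> C B" for A B C
    proof -
      have "{X, Y, Z} \<subseteq> K" and nc: "\<not> collinear {A, B, C}"
        unfolding ABC using por by (simp_all add: poristic_triangle_def)
      then have "A \<in> K" "B \<in> K" "C \<in> K" unfolding ABC[symmetric] by blast+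
      moreover from nc have "C \<noteq> A" "C \<noteq> B" by (auto simp: insert_commute)
      ultimately have "construction K E D C A B"
        using t far tan nc by (intro construction_of_triangle[OF E(1)] foot_ne_farthest) auto
      with ABC show ?thesis by blast
    qed
    have t: "tangent_line \<gamma> X Y" "tangent_line \<gamma> Y Z" "tangent_line \<gamma> Z X"
      using por by (auto simp: poristic_triangle_def circumscribed_def)
    have "tangent_line \<gamma> B A" if "tangent_line \<gamma> A B" for A B
    proof -
      have "A \<noteq> B" using that by (simp add: tangent_line_def)
      then show ?thesis using that tan(2)[of A B] tan(2)[of B A] by (simp add: insert_commute)
    qed
    then have t': "tangent_line \<gamma> Y X" "tangent_line \<gamma> Z Y" "tangent_line \<gamma> X Z"
      using t by blast+
    have "dist D Y \<le> dist D X \<and> dist D Z \<le> dist D X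
      \<or> dist D X \<le> dist D Y \<and> dist D Z \<le> dist D Y
      \<or> dist D X \<le> dist D Z \<and> dist D Y \<le> dist D Z" by linarith
    then consider "dist D Y \<le> dist D X" "dist D Z \<le> dist D X"
      | "dist D X \<le> dist D Y" "dist D Z \<le> dist D Y"
      | "dist D X \<le> dist D Z" "dist D Y \<le> dist D Z" by blast
    then show "\<exists>A B C. {A, B, C} = {X, Y, Z} \<and> construction K E D C A B"
    proof cases
      case 1 then show ?thesis using t t' by (intro main[of Y Z X]) auto
    next
      case 2 then show ?thesis using t t' by (intro main[of X Z Y]) auto
    next
      case 3 then show ?thesis using t t' by (intro main[of X Y Z]) auto
    qed
  qed
qed

end
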